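(* Consider the service time $v$, arrival model, thresholds $K^n$ and iid measurement error $\varepsilon$ described in the context. Suppose the distribution of the estimation error is regularly varying; in particular, there exists a function $\xi:(0,\infty)\to(0,\infty)$ such that for any $a>0$, $\lim_{x\to\infty}\bar\Phi(ax)/\bar\Phi(x)=\xi(a)$. Under Assumptions 1--4 of the context, if $$\lim_{x\to\infty}\frac{x\bar F(x)}{\bar\Phi(x)}=c<\infty,$$ then $\lim_{n\to\infty}\hat\mu_2^n>0$.
   Context: Model. For each (sufficiently large) $n$ there is a $GI/GI/1$ queue, starting empty at time $0$. Fix $\beta>0$ and put $\lambda^n=1-\beta/\sqrt n$. Interarrival times are iid with the law of $\tau^\infty/\lambda^n$, where $\tau^\infty$ is a nonnegative random variable with $E[\tau^\infty]=1$. Service times are iid, independent of the arrivals, with the law of a nonnegative random variable $v$ that does not depend on $n$; $E[v]=1$, $F$ is the cdf of $v$, $\bar F=1-F$. Measurement errors. The estimated service time of a job with service time $v$ is $\hat v=v+\varepsilon$, where the errors are iid over jobs with the law of $\varepsilon$ (not depending on $n$) and independent of the service times. $\varepsilon$ has finite mean and variance and is a continuous random variable with cdf $\Phi$ and $\bar\Phi=1-\Phi$. Given a deterministic threshold $K^n$, jobs with estimated service time $\le K^n$ are assigned to Class 1 and all others to Class 2. The service rate of classified Class 2 jobs is $$\hat\mu_2^n=\frac{1}{E[v\mid v+\varepsilon\ge K^n]}=\frac{\int_0^\infty f(t)\bar\Phi(K^n-t)\,dt}{\int_0^\infty tf(t)\bar\Phi(K^n-t)\,dt}.$$ Assumption 1.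 $v$ has a continuous distribution with density $f$; there is $C>0$ with $f(x)>0$ for all $x>C$; there is $\delta>0$ with $E[v^{2+\delta}]<\infty$. Assumption 2. There is $\epsilon>0$ such that $E[\exp(\theta\tau^\infty)]<\infty$ for all $\theta\in(-\epsilon,\epsilon)$. Assumption 3. Let $\psi_a(\theta)=\log E[\exp(\theta\tau^\infty)]$ and $\bar\theta=\inf\{\theta:\psi_a(\theta)=\infty\}$ (with $\inf\emptyset=+\infty$ and $\psi_a(+\infty)=+\infty$). Then $\psi_a$ is differentiable on $(-\infty,\bar\theta)$ and $\lim_{\theta\uparrow\bar\theta}\psi_a(\theta)=\psi_a(\bar\theta)$; and if $\psi_a(\bar\theta)<\infty$, then $\lim_{\theta\uparrow\bar\theta}\psi_a'(\theta)=\infty$. Assumption 4. $K^n\to\infty$, and there is $\delta\in(0,1/2)$ such that $n^{1/2-\delta}\bar F(K^n)\to\infty$ as $n\to\infty$. *)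

theory Defs
  imports "HOL-Probability.Probability"
begin

definition ccdf :: "'a measure \<Rightarrow> ('a \<Rightarrow> real) \<Rightarrow> real \<Rightarrow> real" where
  "ccdf M X x = 1 - cdf (distr M borel X) x"

definition arrival_rate :: "real \<Rightarrow> nat \<Rightarrow> real" where
  "arrival_rate \<beta> n = 1 - \<beta> / sqrt (real n)"

text \<open>
  Primitive data of a single-server queue: \<open>T i\<close> and \<open>S i\<close> are the \<open>i\<close>-th interarrival and
  service time, with laws \<open>LT\<close> and \<open>LS\<close>. No job is present other than those generated by \<open>T\<close>,
  so the system starts empty.
\<close>

locale gi_gi_1 = prob_space M
  for M :: "'a measure" +
  fixes T S :: "nat \<Rightarrow> 'a \<Rightarrow> real"
    and LT LS :: "real measure"
  assumes indep_interarrivals: "indep_vars (\<lambda>_. borel) T UNIV"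
    and interarrival_law: "\<And>i. distr M borel (T i) = LT"
    and indep_services: "indep_vars (\<lambda>_. borel) S UNIV"
    and service_law: "\<And>i. distr M borel (S i) = LS"
    and services_indep_arrivals:
      "indep_var (\<Pi>\<^sub>M i\<in>UNIV. borel) (\<lambda>\<omega> i. T i \<omega>) (\<Pi>\<^sub>M i\<in>UNIV. borel) (\<lambda>\<omega> i. S i \<omega>)"

locale gi_gi_1_estimated = gi_gi_1 M T S LT LS
  for M :: "'a measure" and T S :: "nat \<Rightarrow> 'a \<Rightarrow> real" and LT LS :: "real measure" +
  fixes E :: "nat \<Rightarrow> 'a \<Rightarrow> real"
    and LE :: "real measure"
  assumes indep_errors: "indep_vars (\<lambda>_. borel) E UNIV"
    and error_law: "\<And>i. distr M borel (E i) = LE"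
    and errors_indep_services:
      "indep_var (\<Pi>\<^sub>M i\<in>UNIV. borel) (\<lambda>\<omega> i. S i \<omega>) (\<Pi>\<^sub>M i\<in>UNIV. borel) (\<lambda>\<omega> i. E i \<omega>)"

text \<open>
  \<open>\<tau>\<close>, \<open>v\<close>, \<open>\<epsilon>\<close> on \<open>P\<close> are the generic variables whose laws drive all the queues; the \<open>n\<close>-th
  queue lives on its own probability space \<open>Q n\<close>. It is only required to exist for large \<open>n\<close>,
  where the arrival rate is positive. \<open>\<epsilon>\<close> is continuous in the sense that its
  distribution function is continuous; a density is not required.
\<close>

locale estimated_queue_sequence = prob_space P
  for P :: "'a measure" +
  fixes \<tau> v \<epsilon> :: "'a \<Rightarrow> real"
    and \<beta> :: real
    and Q :: "nat \<Rightarrow> 'b measure"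
    and T S E :: "nat \<Rightarrow> nat \<Rightarrow> 'b \<Rightarrow> real"
  assumes beta_pos: "\<beta> > 0"
    and rv_interarrival: "random_variable borel \<tau>"
    and interarrival_nonneg: "AE \<omega> in P. \<tau> \<omega> \<ge> 0"
    and interarrival_mean: "expectation \<tau> = 1"
    and rv_service: "random_variable borel v"
    and service_nonneg: "AE \<omega> in P. v \<omega> \<ge> 0"
    and service_mean: "expectation v = 1"
    and rv_error: "random_variable borel \<epsilon>"
    and error_mean_finite: "integrable P \<epsilon>"
    and error_variance_finite: "integrable P (\<lambda>\<omega>. (\<epsilon> \<omega>)\<^sup>2)"
    and error_continuous: "continuous_on UNIV (cdf (distr P borel \<epsilon>))"
    and service_indep_error: "indep_var borel v borel \<epsilon>"
    and queues: "\<forall>\<^sub>F n in sequentially.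
      gi_gi_1_estimated (Q n) (T n) (S n)
        (distr P borel (\<lambda>\<omega>. \<tau> \<omega> / arrival_rate \<beta> n)) (distr P borel v)
        (E n) (distr P borel \<epsilon>)"

definition service_assumption ::
  "'a measure \<Rightarrow> ('a \<Rightarrow> real) \<Rightarrow> (real \<Rightarrow> real) \<Rightarrow> bool" where
  "service_assumption M v f \<longleftrightarrow>
     (\<forall>x. f x \<ge> 0) \<and> distributed M lborel v (\<lambda>x. ennreal (f x)) \<and>
     (\<exists>C>0. \<forall>x>C. f x > 0) \<and>
     (\<exists>\<delta>>0. integrable M (\<lambda>\<omega>. v \<omega> powr (2 + \<delta>)))"

definition light_tailed :: "'a measure \<Rightarrow> ('a \<Rightarrow> real) \<Rightarrow> bool" where
  "light_tailed M X \<longleftrightarrow>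
     (\<exists>e>0. \<forall>\<theta>\<in>{-e<..<e}. integrable M (\<lambda>\<omega>. exp (\<theta> * X \<omega>)))"

definition log_mgf :: "'a measure \<Rightarrow> ('a \<Rightarrow> real) \<Rightarrow> real \<Rightarrow> ereal" where
  "log_mgf M X \<theta> =
     (let m = \<integral>\<^sup>+ \<omega>. ennreal (exp (\<theta> * X \<omega>)) \<partial>M
      in if m = \<infinity> then \<infinity> else ereal (ln (enn2real m)))"

definition log_mgf_bound :: "'a measure \<Rightarrow> ('a \<Rightarrow> real) \<Rightarrow> ereal" where
  "log_mgf_bound M X = Inf (ereal ` {\<theta>. log_mgf M X \<theta> = \<infinity>})"

text \<open>
  The behaviour of the log-mgf at its (possibly infinite) abscissa. At an infinite abscissa the
  log-mgf takes the value \<open>\<infinity>\<close> by convention, so there only the limit has to be required.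
\<close>

definition steep_log_mgf :: "'a measure \<Rightarrow> ('a \<Rightarrow> real) \<Rightarrow> bool" where
  "steep_log_mgf M X \<longleftrightarrow>
     (\<forall>\<theta>. ereal \<theta> < log_mgf_bound M X \<longrightarrow>
        (\<lambda>s. real_of_ereal (log_mgf M X s)) differentiable (at \<theta>)) \<and>
     (log_mgf_bound M X = \<infinity> \<longrightarrow> (log_mgf M X \<longlongrightarrow> \<infinity>) at_top) \<and>
     (\<forall>b. log_mgf_bound M X = ereal b \<longrightarrow>
        (log_mgf M X \<longlongrightarrow> log_mgf M X b) (at_left b) \<and>
        (log_mgf M X b < \<infinity> \<longrightarrow>
           filterlim (deriv (\<lambda>s. real_of_ereal (log_mgf M X s))) at_top (at_left b)))"

definition threshold_assumption ::
  "'a measure \<Rightarrow> ('a \<Rightarrow> real) \<Rightarrow> (nat \<Rightarrow> real) \<Rightarrow> bool" where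
  "threshold_assumption M v K \<longleftrightarrow>
     filterlim K at_top sequentially \<and>
     (\<exists>\<delta>\<in>{0<..<1/2}. filterlim (\<lambda>n. real n powr (1/2 - \<delta>) * ccdf M v (K n)) at_top sequentially)"

definition regularly_varying_tail :: "'a measure \<Rightarrow> ('a \<Rightarrow> real) \<Rightarrow> bool" where
  "regularly_varying_tail M X \<longleftrightarrow>
     (\<exists>\<xi> :: real \<Rightarrow> real. \<forall>a>0. \<xi> a > 0 \<and>
        ((\<lambda>x. ccdf M X (a * x) / ccdf M X x) \<longlongrightarrow> \<xi> a) at_top)"

text \<open>
  The uniform measure on an event is the conditional probability given that event, so the
  integral below is the elementary conditional expectation of \<open>v\<close> given \<open>v + \<epsilon> \<ge> k\<close>.
\<close>

definition class2_service_rate ::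
  "'a measure \<Rightarrow> ('a \<Rightarrow> real) \<Rightarrow> ('a \<Rightarrow> real) \<Rightarrow> real \<Rightarrow> real" where
  "class2_service_rate M v \<epsilon> k =
     1 / (\<integral>\<omega>. v \<omega> \<partial>uniform_measure M {\<omega> \<in> space M. v \<omega> + \<epsilon> \<omega> \<ge> k})"


lemma (in prob_space) nn_integral_long_jobs:
  assumes X: "distributed M lborel v (\<lambda>x. ennreal (f x))"
    and indep: "indep_var borel v borel \<epsilon>"
    and cont: "continuous_on UNIV (cdf (distr M borel \<epsilon>))"
    and nonneg: "AE \<omega> in M. v \<omega> \<ge> 0"
    and f_nonneg: "\<And>x. f x \<ge> 0"
    and g[measurable]: "g \<in> borel_measurable borel" and g_nonneg: "\<And>x. x \<ge> 0 \<Longrightarrow> g x \<ge> 0"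
  shows "(\<integral>\<^sup>+\<omega>. ennreal (g (v \<omega>)) * indicator {\<omega> \<in> space M. v \<omega> + \<epsilon> \<omega> \<ge> k} \<omega> \<partial>M) =
         (\<integral>\<^sup>+t\<in>{0..}. ennreal (g t * f t * ccdf M \<epsilon> (k - t)) \<partial>lborel)"
proof -
  have v[measurable]: "random_variable borel v" and e[measurable]: "random_variable borel \<epsilon>"
    using indep indep_var_distribution_eq by blast+
  have f'[measurable]: "(\<lambda>x. ennreal (f x)) \<in> borel_measurable borel"
    using distributed_borel_measurable[OF X] by simp
  have [measurable]: "f \<in> borel_measurable borel"
  proof -
    have "(\<lambda>x. enn2real (ennreal (f x))) \<in> borel_measurable borel" by measurable
    then show ?thesis using f_nonneg by simp
  qed
  have dv: "distr M borel v = density lborel (\<lambda>x. ennreal (f x))"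
    using distributed_distr_eq_density[OF X] by (metis distr_cong sets_lborel)
  interpret V: prob_space "distr M borel v" by (rule prob_space_distr) simp
  interpret R: prob_space "distr M borel \<epsilon>" by (rule prob_space_distr) simp
  interpret R': real_distribution "distr M borel \<epsilon>" by standard simp_all
  interpret D: pair_prob_space "distr M borel v" "distr M borel \<epsilon>" ..
  have tail: "emeasure (distr M borel \<epsilon>) {y. y \<ge> k - t} = ennreal (ccdf M \<epsilon> (k - t))" for t
  proof -
    have "isCont (cdf (distr M borel \<epsilon>)) (k - t)"
      using cont by (simp add: continuous_on_eq_continuous_at)
    then have 0: "measure (distr M borel \<epsilon>) {k - t} = 0"
      using R'.isCont_cdf by blast
    have "{y. y \<ge> k - t} = UNIV - ({..k - t} - {k - t})" by auto
    then have "measure (distr M borel \<epsilon>) {y. y \<ge> k - t} =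
               1 - measure (distr M borel \<epsilon>) ({..k - t} - {k - t})"
      using R.prob_compl[of "{..k - t} - {k - t}"] by simp
    also have "measure (distr M borel \<epsilon>) ({..k - t} - {k - t}) =
               measure (distr M borel \<epsilon>) {..k - t}"
      using 0 by (subst R.finite_measure_Diff) auto
    finally have "measure (distr M borel \<epsilon>) {y. y \<ge> k - t} = ccdf M \<epsilon> (k - t)"
      by (simp add: ccdf_def cdf_def)
    then show ?thesis by (simp add: R.emeasure_eq_measure)
  qed
  have tail_nonneg: "ccdf M \<epsilon> x \<ge> 0" for x
    unfolding ccdf_def cdf_def by (simp add: R.prob_le_1)
  have [measurable]: "ccdf M \<epsilon> \<in> borel_measurable borel"
    unfolding ccdf_def[abs_def]
    by (intro borel_measurable_diff borel_measurable_const borel_measurable_continuous_onI cont)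
  let ?h = "\<lambda>(t, y). ennreal (g t) * indicator {p. fst p + snd p \<ge> k} (t, y)"
  have "(\<integral>\<^sup>+\<omega>. ennreal (g (v \<omega>)) * indicator {\<omega> \<in> space M. v \<omega> + \<epsilon> \<omega> \<ge> k} \<omega> \<partial>M) =
        (\<integral>\<^sup>+\<omega>. ?h (v \<omega>, \<epsilon> \<omega>) \<partial>M)"
    by (intro nn_integral_cong) (auto split: split_indicator)
  also have "\<dots> = (\<integral>\<^sup>+p. ?h p \<partial>distr M (borel \<Otimes>\<^sub>M borel) (\<lambda>\<omega>. (v \<omega>, \<epsilon> \<omega>)))"
    by (subst nn_integral_distr) auto
  also have "distr M (borel \<Otimes>\<^sub>M borel) (\<lambda>\<omega>. (v \<omega>, \<epsilon> \<omega>)) = distr M borel v \<Otimes>\<^sub>M distr M borel \<epsilon>"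
    using indep indep_var_distribution_eq by metis
  also have "(\<integral>\<^sup>+p. ?h p \<partial>(distr M borel v \<Otimes>\<^sub>M distr M borel \<epsilon>)) =
             (\<integral>\<^sup>+t. \<integral>\<^sup>+y. ?h (t, y) \<partial>distr M borel \<epsilon> \<partial>distr M borel v)"
    by (rule R.nn_integral_fst[symmetric]) measurable
  also have "\<dots> = (\<integral>\<^sup>+t. ennreal (g t) * ennreal (ccdf M \<epsilon> (k - t)) \<partial>distr M borel v)"
  proof (intro nn_integral_cong)
    fix t
    have "(\<integral>\<^sup>+y. ?h (t, y) \<partial>distr M borel \<epsilon>) =
          (\<integral>\<^sup>+y. ennreal (g t) * indicator {y. y \<ge> k - t} y \<partial>distr M borel \<epsilon>)"
      by (intro nn_integral_cong) (auto split: split_indicator)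
    also have "\<dots> = ennreal (g t) * emeasure (distr M borel \<epsilon>) {y. y \<ge> k - t}"
      by (rule nn_integral_cmult_indicator) simp
    finally show "(\<integral>\<^sup>+y. ?h (t, y) \<partial>distr M borel \<epsilon>) =
                  ennreal (g t) * ennreal (ccdf M \<epsilon> (k - t))"
      by (simp add: tail)
  qed
  also have "\<dots> = (\<integral>\<^sup>+t. ennreal (g t) * ennreal (ccdf M \<epsilon> (k - t)) * indicator {0..} t \<partial>distr M borel v)"
  proof (rule nn_integral_cong_AE)
    have "AE t in distr M borel v. t \<ge> 0"
      using nonneg by (subst AE_distr_iff) auto
    then show "AE t in distr M borel v. ennreal (g t) * ennreal (ccdf M \<epsilon> (k - t)) =
                 ennreal (g t) * ennreal (ccdf M \<epsilon> (k - t)) * indicator {0..} t"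
      by eventually_elim auto
  qed
  also have "\<dots> = (\<integral>\<^sup>+t. ennreal (f t) *
      (ennreal (g t) * ennreal (ccdf M \<epsilon> (k - t)) * indicator {0..} t) \<partial>lborel)"
    unfolding dv by (rule nn_integral_density) measurable
  also have "\<dots> = (\<integral>\<^sup>+t\<in>{0..}. ennreal (g t * f t * ccdf M \<epsilon> (k - t)) \<partial>lborel)"
    by (intro nn_integral_cong)
       (auto split: split_indicator simp: ennreal_mult' f_nonneg g_nonneg tail_nonneg mult_ac)
  finally show ?thesis .
qed

lemma (in prob_space) class2_service_rate_eq_density:
  assumes X: "distributed M lborel v (\<lambda>x. ennreal (f x))"
    and indep: "indep_var borel v borel \<epsilon>"
    and cont: "continuous_on UNIV (cdf (distr M borel \<epsilon>))"
    and nonneg: "AE \<omega> in M. v \<omega> \<ge> 0"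
    and f_nonneg: "\<And>x. f x \<ge> 0"
  shows "class2_service_rate M v \<epsilon> k =
    (LINT t:{0..}|lborel. f t * ccdf M \<epsilon> (k - t)) /
    (LINT t:{0..}|lborel. t * f t * ccdf M \<epsilon> (k - t))"
proof -
  let ?A = "{\<omega> \<in> space M. v \<omega> + \<epsilon> \<omega> \<ge> k}"
  have v[measurable]: "random_variable borel v" and e[measurable]: "random_variable borel \<epsilon>"
    using indep indep_var_distribution_eq by blast+
  have A[measurable]: "?A \<in> sets M" by measurable
  have f'[measurable]: "(\<lambda>x. ennreal (f x)) \<in> borel_measurable borel"
    using distributed_borel_measurable[OF X] by simp
  have [measurable]: "f \<in> borel_measurable borel"
  proof -
    have "(\<lambda>x. enn2real (ennreal (f x))) \<in> borel_measurable borel" by measurable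
    then show ?thesis using f_nonneg by simp
  qed
  interpret R: prob_space "distr M borel \<epsilon>" by (rule prob_space_distr) simp
  have tail_nonneg: "ccdf M \<epsilon> x \<ge> 0" for x
    unfolding ccdf_def cdf_def by (simp add: R.prob_le_1)
  have [measurable]: "ccdf M \<epsilon> \<in> borel_measurable borel"
    unfolding ccdf_def[abs_def]
    by (intro borel_measurable_diff borel_measurable_const borel_measurable_continuous_onI cont)
  have set_int: "(LINT t:{0..}|lborel. g t * f t * ccdf M \<epsilon> (k - t)) =
      enn2real (\<integral>\<^sup>+t\<in>{0..}. ennreal (g t * f t * ccdf M \<epsilon> (k - t)) \<partial>lborel)"
    if [measurable]: "g \<in> borel_measurable borel" and "\<And>t. t \<ge> 0 \<Longrightarrow> g t \<ge> 0" for g :: "real \<Rightarrow> real"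
    unfolding set_lebesgue_integral_def
    by (subst integral_eq_nn_integral)
       (auto intro!: arg_cong[where f = enn2real] nn_integral_cong
             split: split_indicator simp: that f_nonneg tail_nonneg)
  have enn2real_div: "enn2real (x / ennreal r) = enn2real x / r" if "r \<ge> 0" for x :: ennreal and r
  proof (cases "r = 0")
    case True
    then show ?thesis by (cases "x = 0") (simp_all add: ennreal_divide_zero)
  next
    case False
    with that show ?thesis
      by (cases x) (simp_all add: divide_ennreal ennreal_top_divide)
  qed
  note nn = nn_integral_long_jobs[OF X indep cont nonneg f_nonneg]
  have "measure M ?A = enn2real (\<integral>\<^sup>+\<omega>. ennreal 1 * indicator ?A \<omega> \<partial>M)"
    by (simp add: measure_def)
  also have "\<dots> = (LINT t:{0..}|lborel. f t * ccdf M \<epsilon> (k - t))"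
    using nn[of "\<lambda>_. 1" k] set_int[of "\<lambda>_. 1"] by simp
  finally have num: "measure M ?A = (LINT t:{0..}|lborel. f t * ccdf M \<epsilon> (k - t))" .
  have "AE \<omega> in uniform_measure M ?A. v \<omega> \<ge> 0"
    using nonneg by (intro AE_uniform_measureI) auto
  then have "(\<integral>\<omega>. v \<omega> \<partial>uniform_measure M ?A) = enn2real (\<integral>\<^sup>+\<omega>. v \<omega> \<partial>uniform_measure M ?A)"
    by (intro integral_eq_nn_integral) auto
  also have "\<dots> = enn2real ((\<integral>\<^sup>+\<omega>. ennreal (v \<omega>) * indicator ?A \<omega> \<partial>M) / emeasure M ?A)"
    by (subst nn_integral_uniform_measure) auto
  also have "\<dots> = (LINT t:{0..}|lborel. t * f t * ccdf M \<epsilon> (k - t)) / measure M ?A"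
    using nn[of "\<lambda>t. t" k] set_int[of "\<lambda>t. t"]
    by (simp add: enn2real_div emeasure_eq_measure)
  finally show ?thesis
    by (simp add: class2_service_rate_def num)
qed

end

theory Submission
  imports Defs "HOL-Real_Asymp.Real_Asymp"
begin

text \<open>
  Integrating out the error makes the mean service time of a classified Class 2 job a quotient of two
  expectations over \<open>v\<close> alone. With \<open>\<phi>\<close> the tail of \<open>\<epsilon>\<close>,
  \<open>1 / \<mu>\<^sub>2(k) = E[v \<phi>(k - v)] / E[\<phi>(k - v)]\<close>,
  and numerator and denominator are both of exact order \<open>\<phi>(k)\<close>.

  A large \<open>v + \<epsilon>\<close> is caused by a single large summand, and \<open>big_jump\<close> turns this into a limit:
  for a nonnegative integrable weight \<open>w\<close>,
  \<open>E[w \<phi>(k - v)] / \<phi>(k)\<close> tends to \<open>E[w]\<close> plus the limit of \<open>E[w; v > x] / \<phi>(x)\<close>.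
  The term \<open>E[w]\<close> comes from bounded \<open>v\<close> and a large error, the other one from a large \<open>v\<close> and an
  ordinary error. Everything then depends on the truncated moments \<open>E[w; v > x]\<close>.

  For \<open>w = 1\<close> the truncated moment is the tail of \<open>v\<close>, which is about \<open>c \<phi>(x) / x\<close> and hence
  negligible, so the denominator is asymptotic to \<open>\<phi>(k)\<close>. For \<open>w = v\<close> it is the tail of \<open>v\<close>
  times \<open>x\<close> plus the integrated tail, and \<open>truncated_mean_asymptotics\<close> finds that its quotient
  by \<open>\<phi>(x)\<close> tends to \<open>L\<close>, where \<open>L\<close> is \<open>c\<close> plus the integral of \<open>c \<xi>(y) / y\<close> over \<open>y \<ge> 1\<close>. This is a form of
  Karamata's theorem; the required domination is \<open>potter_bound\<close>, which rests on the finite variance of the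
  error. As \<open>E[v] = 1\<close>, the service rate tends to \<open>1 / (1 + L)\<close>, and \<open>L\<close> is nonnegative
  because truncated moments of \<open>v\<close> are.
\<close>

section \<open>Tails and truncated means\<close>

lemma (in prob_space) ccdf_eq_prob:
  assumes [measurable]: "random_variable borel X"
  shows "ccdf M X x = prob {\<omega> \<in> space M. x < X \<omega>}"
proof -
  have "cdf (distr M borel X) x = prob {\<omega> \<in> space M. X \<omega> \<le> x}"
    by (simp add: cdf_def measure_distr vimage_def Int_def conj_commute)
  moreover have "prob {\<omega> \<in> space M. x < X \<omega>} = 1 - prob {\<omega> \<in> space M. X \<omega> \<le> x}"
    by (subst prob_neg[symmetric]) (auto simp: not_le)
  ultimately show ?thesis by (simp add: ccdf_def)
qed

lemma ccdf_antimono: "prob_space M \<Longrightarrow> X \<in> borel_measurable M \<Longrightarrow> x \<le> y \<Longrightarrow> ccdf M X y \<le> ccdf M X x"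
  unfolding ccdf_def
  using finite_borel_measure.cdf_nondecreasing[OF real_distribution.finite_borel_measure_M
    [OF prob_space.real_distribution_distr], of M X x y] by simp

lemma borel_measurable_antimono_real:
  fixes g :: "real \<Rightarrow> real"
  assumes "\<And>x y. x \<le> y \<Longrightarrow> g y \<le> g x"
  shows "g \<in> borel_measurable borel"
proof -
  have "(\<lambda>x. - g x) \<in> borel_measurable borel"
    by (rule borel_measurable_mono) (auto intro!: monoI assms)
  then have "(\<lambda>x. - (- g x)) \<in> borel_measurable borel" by measurable
  then show ?thesis by simp
qed

text \<open>
  The layer-cake formula for the excess of \<open>X\<close> over \<open>x\<close>. The integration variable is measured
  in units of \<open>x\<close>, so that the integrand for different \<open>x\<close> lives on the fixed set \<open>y \<ge> 1\<close>
  and regular variation can be applied under the integral sign.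
\<close>
lemma (in prob_space) truncated_mean_eq_integrated_tail:
  assumes int: "integrable M X" and x: "0 < x"
  shows "(\<integral>\<omega>. X \<omega> * indicator {x<..} (X \<omega>) \<partial>M) =
    x * ccdf M X x + x * (\<integral>y. indicator {1..} y * ccdf M X (x * y) \<partial>lborel)"
proof -
  have X[measurable]: "random_variable borel X" using int by simp
  have [measurable]: "ccdf M X \<in> borel_measurable borel"
    by (rule borel_measurable_antimono_real) (simp add: ccdf_antimono[OF prob_space_axioms X])
  have tail_nonneg: "0 \<le> ccdf M X t" for t by (simp add: ccdf_eq_prob)
  interpret pair_sigma_finite M lborel ..
  have "(\<integral>\<^sup>+\<omega>. ennreal (max 0 (X \<omega> - x)) \<partial>M) =
      (\<integral>\<^sup>+\<omega>. \<integral>\<^sup>+y. ennreal x * indicator {(\<omega>, y). 1 \<le> y \<and> x * y < X \<omega>} (\<omega>, y) \<partial>lborel \<partial>M)"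
  proof (intro nn_integral_cong)
    fix \<omega>
    have "(\<integral>\<^sup>+y. ennreal x * indicator {(\<omega>, y). 1 \<le> y \<and> x * y < X \<omega>} (\<omega>, y) \<partial>lborel) =
        (\<integral>\<^sup>+y. ennreal x * indicator {1..<X \<omega> / x} y \<partial>lborel)"
      using x by (intro nn_integral_cong) (auto split: split_indicator simp: field_simps)
    also have "\<dots> = ennreal x * emeasure lborel {1..<X \<omega> / x}"
      by (rule nn_integral_cmult_indicator) simp
    also have "\<dots> = ennreal (max 0 (X \<omega> - x))"
    proof (cases "x \<le> X \<omega>")
      case True
      then show ?thesis using x
        by (simp add: ennreal_mult'[symmetric] right_diff_distrib)
    qed (use x in simp)
    finally show "ennreal (max 0 (X \<omega> - x)) =
      (\<integral>\<^sup>+y. ennreal x * indicator {(\<omega>, y). 1 \<le> y \<and> x * y < X \<omega>} (\<omega>, y) \<partial>lborel)" by simp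
  qed
  also have "\<dots> = (\<integral>\<^sup>+y. \<integral>\<^sup>+\<omega>. ennreal x * indicator {(\<omega>, y). 1 \<le> y \<and> x * y < X \<omega>} (\<omega>, y) \<partial>M \<partial>lborel)"
    by (rule Fubini'[symmetric]) measurable
  also have "\<dots> = (\<integral>\<^sup>+y. ennreal x * ennreal (indicator {1..} y * ccdf M X (x * y)) \<partial>lborel)"
  proof (intro nn_integral_cong)
    fix y
    have "(\<integral>\<^sup>+\<omega>. ennreal x * indicator {(\<omega>, y). 1 \<le> y \<and> x * y < X \<omega>} (\<omega>, y) \<partial>M) =
        (\<integral>\<^sup>+\<omega>. ennreal x * indicator {1..} y * indicator {\<omega> \<in> space M. x * y < X \<omega>} \<omega> \<partial>M)"
      by (intro nn_integral_cong) (auto split: split_indicator)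
    also have "\<dots> = ennreal x * indicator {1..} y * emeasure M {\<omega> \<in> space M. x * y < X \<omega>}"
      by (rule nn_integral_cmult_indicator) simp
    also have "\<dots> = ennreal x * ennreal (indicator {1..} y * ccdf M X (x * y))"
      by (auto split: split_indicator simp: ccdf_eq_prob emeasure_eq_measure)
    finally show "(\<integral>\<^sup>+\<omega>. ennreal x * indicator {(\<omega>, y). 1 \<le> y \<and> x * y < X \<omega>} (\<omega>, y) \<partial>M) =
      ennreal x * ennreal (indicator {1..} y * ccdf M X (x * y))" .
  qed
  also have "\<dots> = ennreal x * (\<integral>\<^sup>+y. ennreal (indicator {1..} y * ccdf M X (x * y)) \<partial>lborel)"
    by (rule nn_integral_cmult) measurable
  finally have nn: "(\<integral>\<^sup>+\<omega>. ennreal (max 0 (X \<omega> - x)) \<partial>M) = \<dots>" .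
  have excess: "(\<integral>\<omega>. max 0 (X \<omega> - x) \<partial>M) = x * (\<integral>y. indicator {1..} y * ccdf M X (x * y) \<partial>lborel)"
  proof -
    have "(\<integral>\<omega>. max 0 (X \<omega> - x) \<partial>M) = enn2real (\<integral>\<^sup>+\<omega>. ennreal (max 0 (X \<omega> - x)) \<partial>M)"
      by (rule integral_eq_nn_integral) auto
    moreover have "(\<integral>y. indicator {1..} y * ccdf M X (x * y) \<partial>lborel) =
        enn2real (\<integral>\<^sup>+y. ennreal (indicator {1..} y * ccdf M X (x * y)) \<partial>lborel)"
      by (rule integral_eq_nn_integral) (auto simp: tail_nonneg)
    ultimately show ?thesis using x by (simp only: nn enn2real_mult enn2real_ennreal less_imp_le)
  qed
  have "integrable M (indicat_real {\<omega> \<in> space M. x < X \<omega>})"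
    by (intro integrable_real_indicator) (auto simp: emeasure_eq_measure)
  note [simp] = this
  have "(\<integral>\<omega>. X \<omega> * indicator {x<..} (X \<omega>) \<partial>M) =
      (\<integral>\<omega>. x * indicator {\<omega> \<in> space M. x < X \<omega>} \<omega> + max 0 (X \<omega> - x) \<partial>M)"
    by (intro Bochner_Integration.integral_cong) (auto split: split_indicator simp: max_def)
  also have "\<dots> = x * ccdf M X x + (\<integral>\<omega>. max 0 (X \<omega> - x) \<partial>M)"
    using int by (subst Bochner_Integration.integral_add) (auto simp: ccdf_eq_prob)
  finally show ?thesis by (simp add: excess)
qed

lemma integrable_inverse_square: "integrable lborel (\<lambda>y :: real. indicator {1..} y * (1 / y\<^sup>2))"
proof -
  have "(\<integral>\<^sup>+y. ennreal (1 / y\<^sup>2) * indicator {1 :: real..} y \<partial>lborel) = ennreal (0 - (- 1 / 1))"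
  proof (rule nn_integral_FTC_atLeast[where F = "\<lambda>y. - 1 / y"])
    show "((\<lambda>y :: real. - 1 / y) \<longlongrightarrow> 0) at_top" by real_asymp
    show "((\<lambda>y :: real. - 1 / y) has_real_derivative 1 / y\<^sup>2) (at y)" if "1 \<le> y" for y
      using that by (auto intro!: derivative_eq_intros simp: power2_eq_square)
  qed auto
  moreover have "(\<integral>\<^sup>+y. ennreal (1 / y\<^sup>2) * indicator {1 :: real..} y \<partial>lborel) =
      (\<integral>\<^sup>+y. ennreal (norm (indicat_real {1..} y * (1 / y\<^sup>2))) \<partial>lborel)"
    by (intro nn_integral_cong) (auto split: split_indicator)
  ultimately show ?thesis by (intro integrableI_bounded) auto
qed

section \<open>Regularly varying tails\<close>

locale regular_tail =
  fixes \<phi> \<xi> :: "real \<Rightarrow> real"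
  assumes antimono: "x \<le> y \<Longrightarrow> \<phi> y \<le> \<phi> x"
    and pos: "0 < \<phi> x"
    and le_one: "\<phi> x \<le> 1"
    and at_top_zero: "(\<phi> \<longlongrightarrow> 0) at_top"
    and at_bot_one: "(\<phi> \<longlongrightarrow> 1) at_bot"
    and ratio_limit_pos: "0 < a \<Longrightarrow> 0 < \<xi> a"
    and ratio: "0 < a \<Longrightarrow> ((\<lambda>x. \<phi> (a * x) / \<phi> x) \<longlongrightarrow> \<xi> a) at_top"
begin

lemma filterlim_scale_at_top: "0 < a \<Longrightarrow> filterlim (\<lambda>x::real. a * x) at_top at_top"
  by (rule filterlim_tendsto_pos_mult_at_top[OF tendsto_const _ filterlim_ident])

lemma ratio_limit_mult:
  assumes "0 < a" "0 < b"
  shows "\<xi> (a * b) = \<xi> a * \<xi> b"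
proof -
  have "((\<lambda>x. \<phi> (a * (b * x)) / \<phi> (b * x) * (\<phi> (b * x) / \<phi> x)) \<longlongrightarrow> \<xi> a * \<xi> b) at_top"
    by (intro tendsto_mult ratio filterlim_compose[OF ratio filterlim_scale_at_top] assms)
  moreover have "(\<lambda>x. \<phi> (a * (b * x)) / \<phi> (b * x) * (\<phi> (b * x) / \<phi> x)) = (\<lambda>x. \<phi> (a * b * x) / \<phi> x)"
    using pos by (simp add: mult.assoc less_imp_neq[symmetric])
  ultimately have "((\<lambda>x. \<phi> (a * b * x) / \<phi> x) \<longlongrightarrow> \<xi> a * \<xi> b) at_top" by (simp only:)
  moreover have "((\<lambda>x. \<phi> (a * b * x) / \<phi> x) \<longlongrightarrow> \<xi> (a * b)) at_top"
    using assms by (intro ratio) simp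
  ultimately show ?thesis
    by (intro tendsto_unique[OF trivial_limit_at_top_linorder])
qed

lemma ratio_limit_one: "\<xi> 1 = 1"
  using ratio_limit_mult[of 1 1] ratio_limit_pos[of 1] by simp

lemma ratio_limit_power: "0 < a \<Longrightarrow> \<xi> (a ^ m) = \<xi> a ^ m"
  by (induction m) (simp_all add: ratio_limit_one ratio_limit_mult)

lemma ratio_limit_antimono:
  assumes "0 < a" "a \<le> b"
  shows "\<xi> b \<le> \<xi> a"
proof (rule tendsto_le[OF trivial_limit_at_top_linorder])
  show "((\<lambda>x. \<phi> (a * x) / \<phi> x) \<longlongrightarrow> \<xi> a) at_top" "((\<lambda>x. \<phi> (b * x) / \<phi> x) \<longlongrightarrow> \<xi> b) at_top"
    using assms by (auto intro: ratio)
  show "\<forall>\<^sub>F x in at_top. \<phi> (b * x) / \<phi> x \<le> \<phi> (a * x) / \<phi> x"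
    using eventually_ge_at_top[of 0]
  proof eventually_elim
    case (elim x)
    then have "\<phi> (b * x) \<le> \<phi> (a * x)" using assms by (intro antimono mult_right_mono)
    then show ?case using pos[of x] by (intro divide_right_mono) auto
  qed
qed

text \<open>
  Continuity of \<open>\<xi>\<close> at 1. As \<open>\<xi>\<close> is multiplicative, its value at the \<open>m\<close>-th root of 2 is the
  \<open>m\<close>-th root of \<open>\<xi> 2\<close>, which tends to 1. One point on each side of 1 is all that the
  monotone sandwich arguments below use.
\<close>
lemma ratio_limit_near_one:
  assumes "0 < e"
  obtains r where "1 < r" "1 - e < \<xi> r" "\<xi> (1 / r) < 1 + e"
proof -
  let ?r = "\<lambda>m. root m (2 :: real)"
  have xi_root: "\<xi> (?r m) = root m (\<xi> 2)" if "0 < m" for m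
  proof -
    have "\<xi> (?r m) ^ m = \<xi> 2"
      using that ratio_limit_power[of "?r m" m] by simp
    then show ?thesis
      using that ratio_limit_pos[of "?r m"] by (intro real_root_pos_unique[symmetric]) auto
  qed
  have lim: "(\<lambda>m. root m (\<xi> 2)) \<longlonglongrightarrow> 1"
    using LIMSEQ_root_const ratio_limit_pos[of 2] by simp
  have lim': "(\<lambda>m. 1 / root m (\<xi> 2)) \<longlonglongrightarrow> 1"
    using tendsto_divide[OF tendsto_const[of 1] lim] by simp
  have "\<forall>\<^sub>F m in sequentially. 1 - e < root m (\<xi> 2) \<and> 1 / root m (\<xi> 2) < 1 + e \<and> 0 < m"
    using assms by (intro eventually_conj order_tendstoD(1)[OF lim] order_tendstoD(2)[OF lim']
        eventually_gt_at_top) auto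
  then obtain m where m: "1 - e < root m (\<xi> 2)" "1 / root m (\<xi> 2) < 1 + e" "0 < m"
    using eventually_happens'[OF trivial_limit_sequentially] by blast
  have r: "1 < ?r m" using m(3) by simp
  then have "\<xi> (1 / ?r m) * \<xi> (?r m) = 1"
    using ratio_limit_mult[of "1 / ?r m" "?r m"] ratio_limit_one by simp
  then have "\<xi> (1 / ?r m) = 1 / root m (\<xi> 2)"
    using xi_root[OF m(3)] by (metis mult_zero_right nonzero_eq_divide_eq zero_neq_one)
  with m r xi_root[OF m(3)] show ?thesis by (intro that[of "?r m"]) auto
qed

text \<open>
  A fixed shift is eventually smaller than any change of scale, so \<open>\<phi> (k - t)\<close> lies between the
  values of \<open>\<phi>\<close> at \<open>r k\<close> and \<open>k / r\<close> for every \<open>r > 1\<close>.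
\<close>
lemma long_tail: "((\<lambda>k. \<phi> (k - t) / \<phi> k) \<longlongrightarrow> 1) at_top"
proof (rule order_tendstoI)
  fix l :: real assume "l < 1"
  then obtain r where r: "1 < r" "l < \<xi> r" using ratio_limit_near_one[of "1 - l"] by auto
  then have "\<forall>\<^sub>F k in at_top. l < \<phi> (r * k) / \<phi> k"
    by (intro order_tendstoD(1)[OF ratio]) auto
  with eventually_ge_at_top[of "- t / (r - 1)"] show "\<forall>\<^sub>F k in at_top. l < \<phi> (k - t) / \<phi> k"
  proof eventually_elim
    case (elim k)
    then have "\<phi> (r * k) \<le> \<phi> (k - t)"
      using r by (intro antimono) (simp add: field_simps)
    then show ?case using elim(2) pos[of k] by (meson divide_right_mono less_imp_le less_le_trans)
  qed
next
  fix u :: real assume "1 < u"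
  then obtain r where r: "1 < r" "\<xi> (1 / r) < u" using ratio_limit_near_one[of "u - 1"] by auto
  then have "\<forall>\<^sub>F k in at_top. \<phi> (1 / r * k) / \<phi> k < u"
    by (intro order_tendstoD(2)[OF ratio]) auto
  with eventually_ge_at_top[of "t / (1 - 1 / r)"] show "\<forall>\<^sub>F k in at_top. \<phi> (k - t) / \<phi> k < u"
  proof eventually_elim
    case (elim k)
    have "0 < 1 - 1 / r" using r by simp
    then have "t \<le> k * (1 - 1 / r)" using elim(1) by (simp only: pos_divide_le_eq)
    then have "\<phi> (k - t) \<le> \<phi> (1 / r * k)"
      by (intro antimono) (simp add: algebra_simps)
    then show ?case using elim(2) pos[of k] by (meson divide_right_mono less_imp_le le_less_trans)
  qed
qed

text \<open>
  If halving at each doubling failed, then \<open>\<phi>\<close> would eventually lose at most a factor 3 per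
  doubling, whereas the bound on \<open>x\<^sup>2 \<phi>(x)\<close> forces a factor of about 4. For a tail
  probability that bound is Chebyshev's inequality.
\<close>
lemma ratio_limit_two_less_half:
  assumes bound: "\<And>x. 0 < x \<Longrightarrow> x\<^sup>2 * \<phi> x \<le> B"
  shows "\<xi> 2 < 1 / 2"
proof (rule ccontr)
  assume "\<not> \<xi> 2 < 1 / 2"
  then have "\<forall>\<^sub>F x in at_top. 1 / 3 < \<phi> (2 * x) / \<phi> x"
    by (intro order_tendstoD(1)[OF ratio]) auto
  then obtain X0 where X0: "\<And>x. X0 \<le> x \<Longrightarrow> 1 / 3 < \<phi> (2 * x) / \<phi> x"
    by (auto simp: eventually_at_top_linorder)
  define X where "X = max X0 1"
  have X: "0 < X" "X0 \<le> X" by (auto simp: X_def)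
  have step: "\<phi> x \<le> 3 * \<phi> (2 * x)" if "X0 \<le> x" for x
    using X0[OF that] pos[of x] by (simp add: field_simps)
  have iter: "\<phi> X \<le> 3 ^ m * \<phi> (2 ^ m * X)" for m
  proof (induction m)
    case (Suc m)
    have "X \<le> 2 ^ m * X" using X by simp
    then have "\<phi> (2 ^ m * X) \<le> 3 * \<phi> (2 * (2 ^ m * X))" using X by (intro step) linarith
    then have "3 ^ m * \<phi> (2 ^ m * X) \<le> 3 ^ m * (3 * \<phi> (2 * (2 ^ m * X)))"
      by (intro mult_left_mono) auto
    from order_trans[OF Suc this] show ?case by (simp add: mult_ac)
  qed simp
  have "(4 / 3) ^ m * (X\<^sup>2 * \<phi> X) \<le> B" for m
  proof -
    have "(4 / 3) ^ m * (X\<^sup>2 * \<phi> X) \<le> (4 / 3) ^ m * (X\<^sup>2 * (3 ^ m * \<phi> (2 ^ m * X)))"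
      using iter[of m] X by (intro mult_left_mono) auto
    also have "\<dots> = (2 ^ m * X)\<^sup>2 * \<phi> (2 ^ m * X)"
      by (simp add: power_mult_distrib power_divide power2_eq_square flip: power_mult_distrib)
    also have "\<dots> \<le> B" using X by (intro bound) auto
    finally show ?thesis .
  qed
  moreover obtain m where "B / (X\<^sup>2 * \<phi> X) < (4 / 3 :: real) ^ m"
    using real_arch_pow[of "4 / 3 :: real"] by auto
  moreover have "0 < X\<^sup>2 * \<phi> X" using X pos by simp
  ultimately show False by (metis not_le pos_divide_less_eq)
qed

text \<open>
  Obtained by iterating \<open>\<phi> (2 x) \<le> \<phi> x / 2\<close> along the powers
  of 2 below \<open>y\<close>. The power \<open>1 / y\<close> suffices for the domination in
  \<open>truncated_mean_asymptotics\<close>, where another factor \<open>1 / y\<close> is available.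
\<close>
lemma potter_bound:
  assumes half: "\<xi> 2 < 1 / 2"
  obtains X where "0 < X" "\<And>x y. X \<le> x \<Longrightarrow> 1 \<le> y \<Longrightarrow> \<phi> (x * y) \<le> 2 / y * \<phi> x"
proof -
  have "\<forall>\<^sub>F x in at_top. \<phi> (2 * x) / \<phi> x < 1 / 2"
    using half by (intro order_tendstoD(2)[OF ratio]) auto
  then obtain X0 where X0: "\<And>x. X0 \<le> x \<Longrightarrow> \<phi> (2 * x) / \<phi> x < 1 / 2"
    by (auto simp: eventually_at_top_linorder)
  define X where "X = max X0 1"
  have X: "0 < X" "X0 \<le> X" by (auto simp: X_def)
  have iter: "2 ^ m * \<phi> (2 ^ m * x) \<le> \<phi> x" if "X \<le> x" for m x
  proof (induction m)
    case (Suc m)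
    have "x \<le> 2 ^ m * x" using X that by simp
    then have "\<phi> (2 * (2 ^ m * x)) / \<phi> (2 ^ m * x) < 1 / 2"
      using that X by (intro X0) linarith
    then have "2 * \<phi> (2 * (2 ^ m * x)) \<le> \<phi> (2 ^ m * x)"
      using pos[of "2 ^ m * x"] by (simp add: field_simps)
    then have "2 ^ m * (2 * \<phi> (2 * (2 ^ m * x))) \<le> 2 ^ m * \<phi> (2 ^ m * x)"
      by (intro mult_left_mono) auto
    from order_trans[OF this Suc] show ?case by (simp add: mult_ac)
  qed simp
  show ?thesis
  proof (rule that[OF X(1)])
    fix x y :: real assume x: "X \<le> x" and y: "1 \<le> y"
    \<comment> \<open>the last power of 2 that does not exceed \<open>y\<close>\<close>
    define m where "m = nat \<lfloor>log 2 y\<rfloor>"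
    have "real m = of_int \<lfloor>log 2 y\<rfloor>" using y by (simp add: m_def)
    then have "real m \<le> log 2 y" "log 2 y < real (Suc m)" by linarith+
    then have m: "2 ^ m \<le> y" "y < 2 ^ Suc m"
      using y by (simp_all add: le_log_iff log_less_iff powr_realpow del: of_nat_Suc power_Suc)
    have "\<phi> (x * y) \<le> \<phi> (2 ^ m * x)" using m x X by (intro antimono) (simp add: mult.commute)
    moreover have "y * \<phi> (x * y) \<le> 2 * 2 ^ m * \<phi> (x * y)"
      using m pos[of "x * y"] by (intro mult_right_mono) auto
    moreover have "2 ^ m * \<phi> (x * y) \<le> 2 ^ m * \<phi> (2 ^ m * x)"
      using calculation by (intro mult_left_mono) auto
    ultimately have "y * \<phi> (x * y) \<le> 2 * \<phi> x" using iter[OF x, of m] by linarith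
    then show "\<phi> (x * y) \<le> 2 / y * \<phi> x" using y by (simp add: field_simps)
  qed
qed

lemma measurable_tail[measurable]: "\<phi> \<in> borel_measurable borel"
  by (rule borel_measurable_antimono_real) (rule antimono)


lemma measurable_ratio_limit: "(\<lambda>y. indicator {1..} y * \<xi> y) \<in> borel_measurable borel"
proof (rule borel_measurable_LIMSEQ_real)
  show "(\<lambda>n. indicator {1..} y * (\<phi> (y * real n) / \<phi> (real n))) \<longlonglongrightarrow> indicator {1..} y * \<xi> y" for y
    using filterlim_compose[OF ratio filterlim_real_sequentially]
    by (cases "1 \<le> y") (auto simp: indicator_def)
qed measurable

section \<open>The principle of a single big jump\<close>

text \<open>
  The integral is cut at \<open>v = k / 2\<close>. On \<open>v \<le> k / 2\<close> the ratio \<open>\<phi>(k - v) / \<phi>(k)\<close> is bounded by about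
  \<open>\<xi> (1/2)\<close> and tends to 1 pointwise, so dominated convergence gives the expectation of \<open>w\<close>.
  On \<open>v > k / 2\<close> the factor \<open>\<phi>(k - v)\<close> is near 0 when \<open>v\<close> is well below \<open>k\<close> and near 1 when \<open>v\<close> is
  well above \<open>k\<close>; since the truncated moment of \<open>w\<close> at \<open>a k\<close>, divided by \<open>\<phi>(k)\<close>, tends to \<open>L \<xi>(a)\<close>, the window
  between \<open>k / r\<close> and \<open>r k\<close> contributes little for \<open>r\<close> close to 1.
\<close>
lemma big_jump:
  fixes M :: "'a measure" and v w :: "'a \<Rightarrow> real"
  assumes v[measurable]: "v \<in> borel_measurable M"
    and w: "integrable M w" and w_nonneg: "AE \<omega> in M. 0 \<le> w \<omega>"
    and tail: "((\<lambda>x. (\<integral>\<omega>. w \<omega> * indicator {x<..} (v \<omega>) \<partial>M) / \<phi> x) \<longlongrightarrow> L) at_top"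
  shows "((\<lambda>k. (\<integral>\<omega>. w \<omega> * \<phi> (k - v \<omega>) \<partial>M) / \<phi> k) \<longlongrightarrow> (\<integral>\<omega>. w \<omega> \<partial>M) + L) at_top"
proof -
  have w_meas[measurable]: "w \<in> borel_measurable M" using w by simp
  define H where "H x = (\<integral>\<omega>. w \<omega> * indicator {x<..} (v \<omega>) \<partial>M)" for x
  define body where "body k = (\<integral>\<omega>. w \<omega> * (indicator {..k/2} (v \<omega>) * \<phi> (k - v \<omega>) / \<phi> k) \<partial>M)" for k
  define jump where "jump k = (\<integral>\<omega>. w \<omega> * (indicator {k/2<..} (v \<omega>) * \<phi> (k - v \<omega>)) \<partial>M)" for k
  have bdd: "integrable M (\<lambda>\<omega>. w \<omega> * g \<omega>)"
    if [measurable]: "g \<in> borel_measurable M" and "\<And>\<omega>. \<bar>g \<omega>\<bar> \<le> B" for g B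
  proof (rule Bochner_Integration.integrable_bound)
    show "integrable M (\<lambda>\<omega>. B * w \<omega>)" using w by simp
    show "AE \<omega> in M. norm (w \<omega> * g \<omega>) \<le> norm (B * w \<omega>)"
    proof (intro AE_I2)
      fix \<omega>
      have "\<bar>w \<omega>\<bar> * \<bar>g \<omega>\<bar> \<le> \<bar>w \<omega>\<bar> * \<bar>B\<bar>"
        using that(2)[of \<omega>] by (intro mult_left_mono) auto
      then show "norm (w \<omega> * g \<omega>) \<le> norm (B * w \<omega>)" by (simp add: abs_mult mult.commute)
    qed
  qed measurable
  have phi_abs: "\<bar>\<phi> x\<bar> \<le> 1" for x using pos[of x] le_one[of x] by simp
  have int_H: "integrable M (\<lambda>\<omega>. w \<omega> * indicator {x<..} (v \<omega>))" for x
    by (rule bdd[of _ 1]) (auto split: split_indicator)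
  have int_jump: "integrable M (\<lambda>\<omega>. w \<omega> * (indicator {k/2<..} (v \<omega>) * \<phi> (k - v \<omega>)))" for k
    by (rule bdd[of _ 1]) (auto split: split_indicator simp: phi_abs)
  have split: "(\<integral>\<omega>. w \<omega> * \<phi> (k - v \<omega>) \<partial>M) / \<phi> k = body k + jump k / \<phi> k" for k
  proof -
    have "(\<integral>\<omega>. w \<omega> * \<phi> (k - v \<omega>) \<partial>M) =
      (\<integral>\<omega>. w \<omega> * (indicator {..k/2} (v \<omega>) * \<phi> (k - v \<omega>)) +
            w \<omega> * (indicator {k/2<..} (v \<omega>) * \<phi> (k - v \<omega>)) \<partial>M)"
      by (intro Bochner_Integration.integral_cong) (auto split: split_indicator)
    also have "\<dots> = (\<integral>\<omega>. w \<omega> * (indicator {..k/2} (v \<omega>) * \<phi> (k - v \<omega>)) \<partial>M) + jump k"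
      unfolding jump_def
      by (intro Bochner_Integration.integral_add bdd[of _ 1] int_jump)
         (auto split: split_indicator simp: phi_abs)
    finally show ?thesis by (simp add: body_def add_divide_distrib)
  qed
  have body_lim: "(body \<longlongrightarrow> (\<integral>\<omega>. w \<omega> \<partial>M)) at_top"
    unfolding body_def
  proof (rule integral_dominated_convergence_at_top)
    show "integrable M (\<lambda>\<omega>. (\<xi> (1/2) + 1) * w \<omega>)" using w by simp
    have "\<forall>\<^sub>F k in at_top. \<phi> (1/2 * k) / \<phi> k < \<xi> (1/2) + 1"
      by (intro order_tendstoD(2)[OF ratio]) auto
    then show "\<forall>\<^sub>F k in at_top. AE \<omega> in M.
        norm (w \<omega> * (indicator {..k/2} (v \<omega>) * \<phi> (k - v \<omega>) / \<phi> k)) \<le> (\<xi> (1/2) + 1) * w \<omega>"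
    proof eventually_elim
      case (elim k)
      have q: "indicator {..k/2} t * \<phi> (k - t) / \<phi> k \<le> \<xi> (1/2) + 1" for t
      proof (cases "t \<le> k / 2")
        case True
        then have "\<phi> (k - t) \<le> \<phi> (1/2 * k)" by (intro antimono) simp
        then have "\<phi> (k - t) / \<phi> k \<le> \<phi> (1/2 * k) / \<phi> k" using pos[of k] by (intro divide_right_mono) auto
        with elim True show ?thesis by simp
      qed (use ratio_limit_pos[of "1/2"] in simp)
      show ?case using w_nonneg
      proof eventually_elim
        case (elim \<omega>)
        have "norm (w \<omega> * (indicator {..k/2} (v \<omega>) * \<phi> (k - v \<omega>) / \<phi> k)) =
            w \<omega> * (indicator {..k/2} (v \<omega>) * \<phi> (k - v \<omega>) / \<phi> k)"
          using elim pos[of k] pos[of "k - v \<omega>"] by (simp add: abs_mult)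
        with mult_left_mono[OF q[of "v \<omega>"] elim] show ?case
          by (simp only: mult.commute[of "\<xi> (1/2) + 1"])
      qed
    qed
    show "AE \<omega> in M. ((\<lambda>k. w \<omega> * (indicator {..k/2} (v \<omega>) * \<phi> (k - v \<omega>) / \<phi> k)) \<longlongrightarrow> w \<omega>) at_top"
    proof (intro AE_I2)
      fix \<omega>
      have "((\<lambda>k. w \<omega> * (\<phi> (k - v \<omega>) / \<phi> k)) \<longlongrightarrow> w \<omega> * 1) at_top"
        by (intro tendsto_mult long_tail tendsto_const)
      then have "((\<lambda>k. w \<omega> * (\<phi> (k - v \<omega>) / \<phi> k)) \<longlongrightarrow> w \<omega>) at_top" by simp
      then show "((\<lambda>k. w \<omega> * (indicator {..k/2} (v \<omega>) * \<phi> (k - v \<omega>) / \<phi> k)) \<longlongrightarrow> w \<omega>) at_top"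
      proof (rule Lim_transform_eventually)
        show "\<forall>\<^sub>F k in at_top. w \<omega> * (\<phi> (k - v \<omega>) / \<phi> k) =
            w \<omega> * (indicator {..k/2} (v \<omega>) * \<phi> (k - v \<omega>) / \<phi> k)"
          using eventually_ge_at_top[of "2 * v \<omega>"] by eventually_elim simp
      qed
    qed
  qed measurable
  have H_scale: "((\<lambda>k. H (a * k) / \<phi> k) \<longlongrightarrow> L * \<xi> a) at_top" if "0 < a" for a
  proof -
    have "((\<lambda>k. H (a * k) / \<phi> (a * k) * (\<phi> (a * k) / \<phi> k)) \<longlongrightarrow> L * \<xi> a) at_top"
      using filterlim_compose[OF tail filterlim_scale_at_top[OF that]]
      by (intro tendsto_mult ratio that) (simp add: H_def)
    moreover have "(\<lambda>k. H (a * k) / \<phi> (a * k) * (\<phi> (a * k) / \<phi> k)) = (\<lambda>k. H (a * k) / \<phi> k)"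
      using pos by (simp add: less_imp_neq[symmetric])
    ultimately show ?thesis by (simp only:)
  qed
  have H_nonneg: "0 \<le> H x" for x
    unfolding H_def using w_nonneg by (intro integral_nonneg_AE) (auto split: split_indicator)
  have L_nonneg: "0 \<le> L"
    using tail
    by (rule tendsto_lowerbound) (use H_nonneg pos in \<open>auto simp: H_def intro!: always_eventually divide_nonneg_pos\<close>)
  \<comment> \<open>below \<open>k / r\<close> the error has to be at least \<open>(1 - 1 / r) k\<close>, above \<open>k / r\<close> any error is allowed\<close>
  have upper: "jump k \<le> H (1/2 * k) * \<phi> ((1 - 1 / r) * k) + H (1 / r * k)"
    if r: "1 < r" for r k
  proof -
    have "jump k \<le> (\<integral>\<omega>. w \<omega> * indicator {1/2 * k<..} (v \<omega>) * \<phi> ((1 - 1 / r) * k) +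
        w \<omega> * indicator {1 / r * k<..} (v \<omega>) \<partial>M)"
      unfolding jump_def
    proof (rule integral_mono_AE[OF int_jump])
      show "integrable M (\<lambda>\<omega>. w \<omega> * indicator {1/2 * k<..} (v \<omega>) * \<phi> ((1 - 1 / r) * k) +
          w \<omega> * indicator {1 / r * k<..} (v \<omega>))"
        using int_H by (intro Bochner_Integration.integrable_add integrable_mult_left) auto
      show "AE \<omega> in M. w \<omega> * (indicator {k/2<..} (v \<omega>) * \<phi> (k - v \<omega>)) \<le>
          w \<omega> * indicator {1/2 * k<..} (v \<omega>) * \<phi> ((1 - 1 / r) * k) + w \<omega> * indicator {1 / r * k<..} (v \<omega>)"
        using w_nonneg
      proof eventually_elim
        case (elim \<omega>)
        have "indicator {k/2<..} (v \<omega>) * \<phi> (k - v \<omega>) \<le>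
            indicator {1/2 * k<..} (v \<omega>) * \<phi> ((1 - 1 / r) * k) + indicator {1 / r * k<..} (v \<omega>)"
        proof (cases "v \<omega> \<le> 1 / r * k")
          case True
          then have "\<phi> (k - v \<omega>) \<le> \<phi> ((1 - 1 / r) * k)" by (intro antimono) (simp add: algebra_simps)
          then show ?thesis by (auto split: split_indicator)
        next
          case False
          then show ?thesis using le_one[of "k - v \<omega>"] pos[of "(1 - 1 / r) * k"]
            by (auto split: split_indicator)
        qed
        from mult_left_mono[OF this elim] show ?case by (simp add: algebra_simps)
      qed
    qed
    also have "\<dots> = H (1/2 * k) * \<phi> ((1 - 1 / r) * k) + H (1 / r * k)"
      unfolding H_def using int_H by (subst Bochner_Integration.integral_add) auto
    finally show ?thesis .
  qed
  \<comment> \<open>above \<open>r k\<close> only an error below \<open>(1 - r) k\<close>, a large negative number, can spoil the sum\<close>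
  have lower: "H (r * k) * \<phi> ((1 - r) * k) \<le> jump k" if r: "1 < r" and k: "0 < k" for r k
  proof -
    have "H (r * k) * \<phi> ((1 - r) * k) = (\<integral>\<omega>. w \<omega> * indicator {r * k<..} (v \<omega>) * \<phi> ((1 - r) * k) \<partial>M)"
      unfolding H_def by simp
    also have "\<dots> \<le> jump k"
      unfolding jump_def
    proof (rule integral_mono_AE[OF _ int_jump])
      show "integrable M (\<lambda>\<omega>. w \<omega> * indicator {r * k<..} (v \<omega>) * \<phi> ((1 - r) * k))"
        using int_H by auto
      show "AE \<omega> in M. w \<omega> * indicator {r * k<..} (v \<omega>) * \<phi> ((1 - r) * k) \<le>
          w \<omega> * (indicator {k/2<..} (v \<omega>) * \<phi> (k - v \<omega>))"
        using w_nonneg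
      proof eventually_elim
        case (elim \<omega>)
        have "indicator {r * k<..} (v \<omega>) * \<phi> ((1 - r) * k) \<le> indicator {k/2<..} (v \<omega>) * \<phi> (k - v \<omega>)"
        proof (cases "r * k < v \<omega>")
          case True
          then have "\<phi> ((1 - r) * k) \<le> \<phi> (k - v \<omega>)" by (intro antimono) (simp add: algebra_simps)
          moreover have "k / 2 < r * k" using mult_strict_right_mono[OF r k] k by simp
          ultimately show ?thesis using True by simp
        next
          case False
          then show ?thesis using pos[of "k - v \<omega>"] by simp
        qed
        from mult_left_mono[OF this elim] show ?case by (simp add: mult.assoc)
      qed
    qed
    finally show ?thesis .
  qed
  have jump_lim: "((\<lambda>k. jump k / \<phi> k) \<longlongrightarrow> L) at_top"
  proof (rule order_tendstoI)
    fix u :: real assume u: "L < u"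
    \<comment> \<open>\<open>L + 1\<close> rather than \<open>L\<close>, as \<open>L\<close> may be 0\<close>
    define e where "e = (u - L) / (L + 1)"
    have e: "0 < e" using u L_nonneg by (simp add: e_def)
    obtain r where r: "1 < r" "\<xi> (1 / r) < 1 + e" using ratio_limit_near_one[OF e] by metis
    have "L * \<xi> (1 / r) \<le> L * (1 + e)" using r L_nonneg by (intro mult_left_mono) auto
    also have "\<dots> < L + (L + 1) * e" using e by (simp add: algebra_simps)
    also have "\<dots> = u" using L_nonneg by (simp add: e_def)
    finally have less: "L * \<xi> (1/2) * 0 + L * \<xi> (1 / r) < u" by simp
    have "((\<lambda>k. H (1/2 * k) / \<phi> k * \<phi> ((1 - 1 / r) * k) + H (1 / r * k) / \<phi> k)
        \<longlongrightarrow> L * \<xi> (1/2) * 0 + L * \<xi> (1 / r)) at_top"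
      using r(1)
      by (intro tendsto_add tendsto_mult H_scale filterlim_compose[OF at_top_zero filterlim_scale_at_top]) auto
    then have "\<forall>\<^sub>F k in at_top. H (1/2 * k) / \<phi> k * \<phi> ((1 - 1 / r) * k) + H (1 / r * k) / \<phi> k < u"
      using less by (rule order_tendstoD(2))
    then show "\<forall>\<^sub>F k in at_top. jump k / \<phi> k < u"
    proof eventually_elim
      case (elim k)
      have "jump k / \<phi> k \<le> (H (1/2 * k) * \<phi> ((1 - 1 / r) * k) + H (1 / r * k)) / \<phi> k"
        using upper[OF r(1), of k] pos[of k] by (intro divide_right_mono) auto
      with elim show ?case by (simp add: add_divide_distrib)
    qed
  next
    fix l :: real assume l: "l < L"
    define e where "e = (L - l) / (L + 1)"
    have e: "0 < e" using l L_nonneg by (simp add: e_def)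
    obtain r where r: "1 < r" "1 - e < \<xi> r" using ratio_limit_near_one[OF e] by metis
    have "l = L - (L + 1) * e" using L_nonneg by (simp add: e_def)
    also have "\<dots> < L * (1 - e)" using e by (simp add: algebra_simps)
    also have "\<dots> \<le> L * \<xi> r" using r L_nonneg by (intro mult_left_mono) auto
    finally have less: "l < L * \<xi> r * 1" by simp
    have "filterlim (\<lambda>k. (1 - r) * k) at_bot at_top"
      using r(1) by (intro filterlim_tendsto_neg_mult_at_bot[OF tendsto_const _ filterlim_ident]) simp
    then have "((\<lambda>k. H (r * k) / \<phi> k * \<phi> ((1 - r) * k)) \<longlongrightarrow> L * \<xi> r * 1) at_top"
      using r(1) by (intro tendsto_mult H_scale filterlim_compose[OF at_bot_one]) auto
    then have "\<forall>\<^sub>F k in at_top. l < H (r * k) / \<phi> k * \<phi> ((1 - r) * k)"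
      using less by (rule order_tendstoD(1))
    then show "\<forall>\<^sub>F k in at_top. l < jump k / \<phi> k"
      using eventually_gt_at_top[of 0]
    proof eventually_elim
      case (elim k)
      have "H (r * k) * \<phi> ((1 - r) * k) / \<phi> k \<le> jump k / \<phi> k"
        using lower[OF r(1) elim(2)] pos[of k] by (intro divide_right_mono) auto
      with elim show ?case by simp
    qed
  qed
  show ?thesis
    unfolding split by (intro tendsto_add body_lim jump_lim)
qed

section \<open>Asymptotics of the truncated mean\<close>

text \<open>
  Divided by \<open>\<phi> x\<close>, the integrated tail has the integrand \<open>x ccdf (x y) / \<phi> x\<close>, which converges to
  \<open>c \<xi>(y) / y\<close>: at the argument \<open>x y\<close> the tail of \<open>v\<close> is about \<open>c / (x y)\<close> times \<open>\<phi>\<close>, and \<open>\<phi>\<close>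
  varies regularly. The same factorization and \<open>potter_bound\<close> dominate it by a multiple of
  \<open>1 / y\<^sup>2\<close>.
\<close>
lemma truncated_mean_asymptotics:
  fixes M :: "'a measure"
  assumes M: "prob_space M" and int: "integrable M v"
    and half: "\<xi> 2 < 1 / 2"
    and c: "((\<lambda>x. x * ccdf M v x / \<phi> x) \<longlongrightarrow> c) at_top"
  shows "((\<lambda>x. (\<integral>\<omega>. v \<omega> * indicator {x<..} (v \<omega>) \<partial>M) / \<phi> x) \<longlongrightarrow>
    c + (\<integral>y. indicator {1..} y * (c * \<xi> y / y) \<partial>lborel)) at_top"
proof -
  interpret prob_space M by (rule M)
  have v[measurable]: "random_variable borel v" using int by simp
  have [measurable]: "ccdf M v \<in> borel_measurable borel"
    by (rule borel_measurable_antimono_real) (simp add: ccdf_antimono[OF M v])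
  have tail_nonneg: "0 \<le> ccdf M v t" for t by (simp add: ccdf_eq_prob)
  let ?s = "\<lambda>x y. indicator {1..} y * (x * ccdf M v (x * y) / \<phi> x)"
  have factor: "x * ccdf M v (x * y) / \<phi> x = (x * y * ccdf M v (x * y) / \<phi> (x * y)) * (\<phi> (x * y) / \<phi> x) / y"
    if "1 \<le> y" for x y
    using that pos[of "x * y"] by simp
  obtain X where X: "0 < X" "\<And>x y. X \<le> x \<Longrightarrow> 1 \<le> y \<Longrightarrow> \<phi> (x * y) \<le> 2 / y * \<phi> x"
    using potter_bound[OF half] by metis
  have "\<forall>\<^sub>F x in at_top. x * ccdf M v x / \<phi> x < c + 1"
    by (rule order_tendstoD(2)[OF c]) simp
  then obtain X' where X': "\<And>x. X' \<le> x \<Longrightarrow> x * ccdf M v x / \<phi> x < c + 1"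
    by (auto simp: eventually_at_top_linorder)
  have "((\<lambda>x. \<integral>y. ?s x y \<partial>lborel) \<longlongrightarrow> (\<integral>y. indicator {1..} y * (c * \<xi> y / y) \<partial>lborel)) at_top"
  proof (rule integral_dominated_convergence_at_top)
    show "integrable lborel (\<lambda>y. (c + 1) * 2 * (indicator {1..} y * (1 / y\<^sup>2)))"
      using integrable_inverse_square by (rule integrable_mult_right)
    show "(\<lambda>y. indicator {1..} y * (c * \<xi> y / y)) \<in> borel_measurable lborel"
    proof -
      have "(\<lambda>y. c * (indicator {1..} y * \<xi> y) / y) \<in> borel_measurable borel"
        using measurable_ratio_limit by measurable
      moreover have "(\<lambda>y. c * (indicator {1..} y * \<xi> y) / y) = (\<lambda>y. indicator {1..} y * (c * \<xi> y / y))"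
        by auto
      ultimately show ?thesis by simp
    qed
    show "\<forall>\<^sub>F x in at_top. AE y in lborel. norm (?s x y) \<le> (c + 1) * 2 * (indicator {1..} y * (1 / y\<^sup>2))"
      using eventually_ge_at_top[of "max X X'"]
    proof eventually_elim
      case (elim x)
      show ?case
      proof (intro AE_I2)
        fix y :: real
        show "norm (?s x y) \<le> (c + 1) * 2 * (indicator {1..} y * (1 / y\<^sup>2))"
        proof (cases "1 \<le> y")
          case y: True
          have x: "X \<le> x" "X' \<le> x" "0 < x" using elim X(1) by auto
          then have xy: "x \<le> x * y" using y by simp
          have a: "x * y * ccdf M v (x * y) / \<phi> (x * y) \<le> c + 1" using X'[of "x * y"] x xy by simp
          have b: "\<phi> (x * y) / \<phi> x \<le> 2 / y" using X(2)[OF x(1) y] pos[of x] by (simp add: field_simps)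
          have "(x * y * ccdf M v (x * y) / \<phi> (x * y)) * (\<phi> (x * y) / \<phi> x) \<le> (c + 1) * (2 / y)"
            using a b pos[of x] pos[of "x * y"] x y tail_nonneg[of "x * y"]
            by (intro mult_mono) (auto intro: order_trans[OF _ a])
          then have "x * ccdf M v (x * y) / \<phi> x \<le> (c + 1) * (2 / y) / y"
            unfolding factor[OF y] using y by (intro divide_right_mono) auto
          moreover have "0 \<le> x * ccdf M v (x * y) / \<phi> x" using x pos[of x] tail_nonneg[of "x * y"] by simp
          ultimately show ?thesis using y by (simp add: power2_eq_square)
        qed simp
      qed
    qed
    show "AE y in lborel. ((\<lambda>x. ?s x y) \<longlongrightarrow> indicator {1..} y * (c * \<xi> y / y)) at_top"
    proof (intro AE_I2)
      fix y :: real
      show "((\<lambda>x. ?s x y) \<longlongrightarrow> indicator {1..} y * (c * \<xi> y / y)) at_top"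
      proof (cases "1 \<le> y")
        case y: True
        have "((\<lambda>x. (y * x * ccdf M v (y * x) / \<phi> (y * x)) * (\<phi> (y * x) / \<phi> x) / y) \<longlongrightarrow> c * \<xi> y / y) at_top"
          using y by (intro tendsto_divide tendsto_mult ratio tendsto_const
              filterlim_compose[OF c filterlim_scale_at_top]) auto
        then show ?thesis using y by (simp add: factor mult.commute)
      qed simp
    qed
  qed measurable
  with c have "((\<lambda>x. x * ccdf M v x / \<phi> x + (\<integral>y. ?s x y \<partial>lborel)) \<longlongrightarrow>
      c + (\<integral>y. indicator {1..} y * (c * \<xi> y / y) \<partial>lborel)) at_top"
    by (rule tendsto_add)
  then show ?thesis
  proof (rule Lim_transform_eventually)
    show "\<forall>\<^sub>F x in at_top. x * ccdf M v x / \<phi> x + (\<integral>y. ?s x y \<partial>lborel) =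
        (\<integral>\<omega>. v \<omega> * indicator {x<..} (v \<omega>) \<partial>M) / \<phi> x"
      using eventually_gt_at_top[of 0]
    proof eventually_elim
      case (elim x)
      have "(\<integral>y. ?s x y \<partial>lborel) = (\<integral>y. x / \<phi> x * (indicator {1..} y * ccdf M v (x * y)) \<partial>lborel)"
        by (intro Bochner_Integration.integral_cong) auto
      also have "\<dots> = x / \<phi> x * (\<integral>y. indicator {1..} y * ccdf M v (x * y) \<partial>lborel)"
        by simp
      finally show ?case
        using truncated_mean_eq_integrated_tail[OF int elim] by (simp add: add_divide_distrib)
    qed
  qed
qed

end

section \<open>The limiting service rate\<close>

text \<open>
  Positivity of the tail is implicit in regular variation: a tail that vanishes somewhere vanishes
  from there on, so its ratios would be \<open>0 / 0 = 0\<close> and their limit not positive.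
\<close>
lemma (in prob_space) regular_tail_ccdf:
  assumes X: "random_variable borel X" and reg: "regularly_varying_tail M X"
  obtains \<xi> where "regular_tail (ccdf M X) \<xi>"
proof -
  from reg obtain \<xi> where xi: "\<And>a. 0 < a \<Longrightarrow> 0 < \<xi> a"
    "\<And>a. 0 < a \<Longrightarrow> ((\<lambda>x. ccdf M X (a * x) / ccdf M X x) \<longlongrightarrow> \<xi> a) at_top"
    by (auto simp: regularly_varying_tail_def)
  interpret D: real_distribution "distr M borel X" using X by simp
  have nonneg: "0 \<le> ccdf M X x" for x by (simp add: ccdf_def D.cdf_bounded_prob)
  note anti = ccdf_antimono[OF prob_space_axioms X]
  show ?thesis
  proof (rule that[of \<xi>], unfold_locales)
    show "0 < ccdf M X x" for x
    proof (rule ccontr)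
      assume "\<not> 0 < ccdf M X x"
      then have zero: "ccdf M X y = 0" if "x \<le> y" for y
        using anti[OF that] nonneg[of y] by simp
      have "\<forall>\<^sub>F y in at_top. ccdf M X (1 * y) / ccdf M X y = 0"
        using eventually_ge_at_top[of x] by eventually_elim (simp add: zero)
      then have "((\<lambda>y. ccdf M X (1 * y) / ccdf M X y) \<longlongrightarrow> 0) at_top"
        by (rule tendsto_eventually)
      then have "\<xi> 1 = 0"
        using xi(2)[of 1] tendsto_unique[OF trivial_limit_at_top_linorder] by fastforce
      then show False using xi(1)[of 1] by simp
    qed
    show "(ccdf M X \<longlongrightarrow> 0) at_top"
      using tendsto_diff[OF tendsto_const[of 1] D.cdf_lim_at_top_prob] by (simp add: ccdf_def[abs_def])
    show "(ccdf M X \<longlongrightarrow> 1) at_bot"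
      using tendsto_diff[OF tendsto_const[of 1] D.cdf_lim_at_bot] by (simp add: ccdf_def[abs_def])
    show "ccdf M X x \<le> 1" for x by (simp add: ccdf_def D.cdf_nonneg)
  qed (use xi anti in auto)
qed

lemma (in prob_space) square_tail_bounded:
  assumes X[measurable]: "random_variable borel X" and sq: "integrable M (\<lambda>\<omega>. (X \<omega>)\<^sup>2)" and x: "0 < x"
  shows "x\<^sup>2 * ccdf M X x \<le> expectation (\<lambda>\<omega>. (X \<omega>)\<^sup>2)"
proof -
  have "ccdf M X x \<le> prob {\<omega> \<in> space M. x \<le> \<bar>X \<omega>\<bar>}"
    unfolding ccdf_eq_prob[OF X] by (intro finite_measure_mono) auto
  also have "\<dots> \<le> expectation (\<lambda>\<omega>. (X \<omega>)\<^sup>2) / x\<^sup>2"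
    by (rule second_moment_method[OF X sq x])
  finally show ?thesis using x by (simp add: field_simps)
qed

lemma (in prob_space) class2_service_rate_eq_expectation:
  assumes X: "distributed M lborel v (\<lambda>x. ennreal (f x))"
    and indep: "indep_var borel v borel \<epsilon>"
    and cont: "continuous_on UNIV (cdf (distr M borel \<epsilon>))"
    and nonneg: "AE \<omega> in M. v \<omega> \<ge> 0"
    and f_nonneg: "\<And>x. f x \<ge> 0"
  shows "class2_service_rate M v \<epsilon> k =
    (\<integral>\<omega>. ccdf M \<epsilon> (k - v \<omega>) \<partial>M) / (\<integral>\<omega>. v \<omega> * ccdf M \<epsilon> (k - v \<omega>) \<partial>M)"
proof -
  have v[measurable]: "random_variable borel v" and e[measurable]: "random_variable borel \<epsilon>"
    using indep indep_var_distribution_eq by blast+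
  have [measurable]: "ccdf M \<epsilon> \<in> borel_measurable borel"
    by (rule borel_measurable_antimono_real) (simp add: ccdf_antimono[OF prob_space_axioms e])
  have transfer: "(LINT t:{0..}|lborel. g t * f t * ccdf M \<epsilon> (k - t)) = (\<integral>\<omega>. g (v \<omega>) * ccdf M \<epsilon> (k - v \<omega>) \<partial>M)"
    if [measurable]: "g \<in> borel_measurable borel" for g
  proof -
    have "(LINT t:{0..}|lborel. g t * f t * ccdf M \<epsilon> (k - t)) =
        (\<integral>t. f t * (indicator {0..} t * (g t * ccdf M \<epsilon> (k - t))) \<partial>lborel)"
      unfolding set_lebesgue_integral_def by (simp add: mult_ac)
    also have "\<dots> = (\<integral>\<omega>. indicator {0..} (v \<omega>) * (g (v \<omega>) * ccdf M \<epsilon> (k - v \<omega>)) \<partial>M)"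
      by (rule distributed_integral[OF X]) (auto simp: f_nonneg)
    also have "\<dots> = (\<integral>\<omega>. g (v \<omega>) * ccdf M \<epsilon> (k - v \<omega>) \<partial>M)"
      using nonneg by (intro integral_cong_AE) (auto elim!: eventually_mono)
    finally show ?thesis .
  qed
  show ?thesis
    unfolding class2_service_rate_eq_density[OF X indep cont nonneg f_nonneg]
    using transfer[of "\<lambda>_. 1"] transfer[of "\<lambda>t. t"] by simp
qed

theorem lemma8:
  fixes P :: "'a measure" and \<tau> v \<epsilon> :: "'a \<Rightarrow> real" and \<beta> :: real
    and Q :: "nat \<Rightarrow> 'b measure" and T S E :: "nat \<Rightarrow> nat \<Rightarrow> 'b \<Rightarrow> real"
    and f :: "real \<Rightarrow> real" and K :: "nat \<Rightarrow> real" and c :: real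
  assumes "estimated_queue_sequence P \<tau> v \<epsilon> \<beta> Q T S E"
    and "service_assumption P v f"
    and "light_tailed P \<tau>"
    and "steep_log_mgf P \<tau>"
    and "threshold_assumption P v K"
    and "regularly_varying_tail P \<epsilon>"
    and "((\<lambda>x. x * ccdf P v x / ccdf P \<epsilon> x) \<longlongrightarrow> c) at_top"
  shows "\<exists>\<mu>>0. (\<lambda>n. class2_service_rate P v \<epsilon> (K n)) \<longlonglongrightarrow> \<mu>"
proof -
  interpret estimated_queue_sequence P \<tau> v \<epsilon> \<beta> Q T S E by (rule assms(1))
  note [measurable] = rv_service rv_error
  from assms(2) have density: "\<And>x. 0 \<le> f x" "distributed P lborel v (\<lambda>x. ennreal (f x))"
    by (auto simp: service_assumption_def)
  have K: "filterlim K at_top sequentially"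
    using assms(5) by (simp add: threshold_assumption_def)
  have v_int: "integrable P v"
    using service_mean not_integrable_integral_eq by fastforce
  obtain \<xi> where "regular_tail (ccdf P \<epsilon>) \<xi>"
    using regular_tail_ccdf[OF rv_error assms(6)] .
  then interpret R: regular_tail "ccdf P \<epsilon>" \<xi> .
  have half: "\<xi> 2 < 1 / 2"
    by (rule R.ratio_limit_two_less_half[OF square_tail_bounded[OF rv_error error_variance_finite]])
  define L where "L = c + (\<integral>y. indicator {1..} y * (c * \<xi> y / y) \<partial>lborel)"
  have trunc: "((\<lambda>x. (\<integral>\<omega>. v \<omega> * indicator {x<..} (v \<omega>) \<partial>P) / ccdf P \<epsilon> x) \<longlongrightarrow> L) at_top"
    unfolding L_def by (rule R.truncated_mean_asymptotics[OF prob_space_axioms v_int half assms(7)])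
  have "0 \<le> L"
    using trunc
  proof (rule tendsto_lowerbound)
    have "0 \<le> (\<integral>\<omega>. v \<omega> * indicator {x<..} (v \<omega>) \<partial>P)" for x
      using service_nonneg by (intro integral_nonneg_AE) (auto elim!: eventually_mono)
    then show "\<forall>\<^sub>F x in at_top. 0 \<le> (\<integral>\<omega>. v \<omega> * indicator {x<..} (v \<omega>) \<partial>P) / ccdf P \<epsilon> x"
      using R.pos by (intro always_eventually allI divide_nonneg_pos)
  qed simp
  \<comment> \<open>the work of long jobs: the weight \<open>v\<close>\<close>
  have work: "((\<lambda>k. (\<integral>\<omega>. v \<omega> * ccdf P \<epsilon> (k - v \<omega>) \<partial>P) / ccdf P \<epsilon> k) \<longlongrightarrow> 1 + L) at_top"
    using R.big_jump[OF rv_service v_int service_nonneg trunc] by (simp add: service_mean)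
  \<comment> \<open>the number of long jobs: the weight 1 has the truncated moment \<open>ccdf P v\<close>, of smaller order than \<open>ccdf P \<epsilon>\<close>\<close>
  have "((\<lambda>x. x * ccdf P v x / ccdf P \<epsilon> x * (1 / x)) \<longlongrightarrow> c * 0) at_top"
    by (intro tendsto_mult assms(7)) real_asymp
  then have "((\<lambda>x. x * ccdf P v x / ccdf P \<epsilon> x * (1 / x)) \<longlongrightarrow> 0) at_top" by simp
  then have "((\<lambda>x. (\<integral>\<omega>. 1 * indicat_real {x<..} (v \<omega>) \<partial>P) / ccdf P \<epsilon> x) \<longlongrightarrow> 0) at_top"
  proof (rule Lim_transform_eventually)
    have moment: "(\<integral>\<omega>. 1 * indicat_real {x<..} (v \<omega>) \<partial>P) = ccdf P v x" for x
    proof -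
      have "(\<integral>\<omega>. 1 * indicat_real {x<..} (v \<omega>) \<partial>P) = (\<integral>\<omega>. indicat_real {\<omega> \<in> space P. x < v \<omega>} \<omega> \<partial>P)"
        by (intro Bochner_Integration.integral_cong) (auto split: split_indicator)
      then show ?thesis by (simp add: ccdf_eq_prob)
    qed
    show "\<forall>\<^sub>F x in at_top. x * ccdf P v x / ccdf P \<epsilon> x * (1 / x) =
        (\<integral>\<omega>. 1 * indicat_real {x<..} (v \<omega>) \<partial>P) / ccdf P \<epsilon> x"
      unfolding moment using eventually_gt_at_top[of 0] by eventually_elim simp
  qed
  then have count: "((\<lambda>k. (\<integral>\<omega>. ccdf P \<epsilon> (k - v \<omega>) \<partial>P) / ccdf P \<epsilon> k) \<longlongrightarrow> 1) at_top"
    using R.big_jump[of v P "\<lambda>_. 1" 0] by (simp add: prob_space)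
  have "((\<lambda>k. class2_service_rate P v \<epsilon> k) \<longlongrightarrow> 1 / (1 + L)) at_top"
  proof -
    have "((\<lambda>k. ((\<integral>\<omega>. ccdf P \<epsilon> (k - v \<omega>) \<partial>P) / ccdf P \<epsilon> k) /
        ((\<integral>\<omega>. v \<omega> * ccdf P \<epsilon> (k - v \<omega>) \<partial>P) / ccdf P \<epsilon> k)) \<longlongrightarrow> 1 / (1 + L)) at_top"
      using \<open>0 \<le> L\<close> by (intro tendsto_divide count work) simp
    moreover have "class2_service_rate P v \<epsilon> k =
        ((\<integral>\<omega>. ccdf P \<epsilon> (k - v \<omega>) \<partial>P) / ccdf P \<epsilon> k) /
        ((\<integral>\<omega>. v \<omega> * ccdf P \<epsilon> (k - v \<omega>) \<partial>P) / ccdf P \<epsilon> k)" for k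
      using R.pos[of k]
      by (simp add: class2_service_rate_eq_expectation[OF density(2) service_indep_error
            error_continuous service_nonneg density(1)])
    ultimately show ?thesis by simp
  qed
  from filterlim_compose[OF this K] have "(\<lambda>n. class2_service_rate P v \<epsilon> (K n)) \<longlonglongrightarrow> 1 / (1 + L)" .
  with \<open>0 \<le> L\<close> show ?thesis by (intro exI[of _ "1 / (1 + L)"]) simp
qed

end
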